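(* Let $f:\mathbb{R}^n\times\mathbb{R}^m\to\mathbb{R}^n$ be continuously differentiable, let $L:\mathbb{R}^n\times\mathbb{R}^m\to\mathbb{R}$, $h:\mathbb{R}^n\times\mathbb{R}^m\to\mathbb{R}^s$, and $t_{\rm f}>0$. Consider the optimal control problem of maximising the cost functional $J(x_0,u)=\int_0^{t_{\rm f}}L(x(t),u(t))\,{\rm d}t$ over all piecewise continuous $u:[0,t_{\rm f}]\to\mathbb{R}^m$, subject to $$\dot x(t)=f(x(t),u(t)),\qquad x(0)=x_0,$$ and the constraint $h(x(t),u(t))\ge 0$. Assume that: (H1) the system is a monotone control system; (H2) $L$ is continuous, and $L(\xi_1,v_1)\le L(\xi_2,v_2)$ for all $(\xi_1,v_1),(\xi_2,v_2)\in\mathbb{R}^n\times\mathbb{R}^m$ with $(\xi_1,v_1)\le(\xi_2,v_2)$; (H3) one of the following holds: (a) for all $\xi\in\mathbb{R}^n$ and all $v_1,v_2\in\mathbb{R}^m$ with $v_1<v_2$, $L(\xi,v_1)<L(\xi,v_2)$; or (b) the system is excitable and, for all $v\in\mathbb{R}^m$ and all $\xi_1,\xi_2\in\mathbb{R}^n$ with $\xi_1\ll\xi_2$, $L(\xi_1,v)<L(\xi_2,v)$; (H4) $h$ is continuous, and every component $h_k$ of $h$ is non-increasing in each input component $u_j$. Fix $x_0\in\mathbb{R}^n$ and let $(u,x)$ denote an admissible trajectory with piecewise continuous $u$. If there exists $t_0<t_{\rm f}$ such that $$h(x(t),u(t))\gg 0\quad\text{for all } t\in[t_0,t_{\rm f}],$$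 then $(u,x)$ is not optimal.
   Context: Order notation: for vectors $x,y$ of the same dimension, $x\le y$ means $x_i\le y_i$ for all $i$; $x<y$ means $x\le y$ and $x\ne y$; $x\ll y$ means $x_i<y_i$ for all $i$; $\ge,>,\gg$ are defined analogously. $L^\infty_{\rm loc}(\mathbb{R}_+,\mathbb{R}^m)$ denotes the measurable, locally essentially bounded functions $\mathbb{R}_+\to\mathbb{R}^m$. For $u_1,u_2$ in this space, $u_1\le u_2$ means $u_1(t)\le u_2(t)$ for almost all $t\ge0$, and $u_1<u_2$ means $u_1(t)<u_2(t)$ for almost all $t\ge 0$. Standing assumption: for all $\tau>0$, all $x_0\in\mathbb{R}^n$ and all measurable, locally essentially bounded $u$, there is a unique solution on $[0,\tau]$ of $\dot x=f(x,u)$, $x(0)=x_0$, that is, an absolutely continuous $x:[0,\tau]\to\mathbb{R}^n$ satisfying this almost everywhere. It is denoted $x(t)=x(t;x_0,u)$, and the pair $(u,x)$ is called a trajectory. Monotone control system: for all $t\ge0$, $\xi_1,\xi_2\in\mathbb{R}^n$ and $u_1,u_2\in L^\infty_{\rm loc}(\mathbb{R}_+,\mathbb{R}^m)$, if $\xi_1\le\xi_2$ and $u_1\le u_2$ then $x(t;\xi_1,u_1)\le x(t;\xi_2,u_2)$. Excitable: for all $\xi\in\mathbb{R}^n$ and all $u_1,u_2\in L^\infty_{\rm loc}(\mathbb{R}_+,\mathbb{R}^m)$ with $u_1<u_2$, $x(t;\xi,u_1)\ll x(t;\xi,u_2)$ for all $t>0$. Admissible trajectory: a trajectory $(u,x)$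 with $x$ defined on $[0,t_{\rm f}]$ and which satisfies the constraint $h(x(t),u(t))\ge0$ (componentwise) on $[0,t_{\rm f}]$. Optimal: an admissible trajectory $(u,x)$ with $x(0)=x_0$ and piecewise continuous $u$ is optimal if it maximises $J(x_0,\cdot)$ among all admissible trajectories with initial state $x_0$ and piecewise continuous input on $[0,t_{\rm f}]$. *)

theory Defs
  imports "HOL-Analysis.Analysis"
begin

text \<open>
  The library orders \<open>\<le>\<close> and \<open><\<close> on \<^typ>\<open>real ^ 'n\<close> are the intended ones:
  \<open>x \<le> y\<close> is componentwise, and \<open>x < y\<close> means \<open>x \<le> y\<close> and \<open>x \<noteq> y\<close>.
\<close>

definition vec_ll :: "real ^ 'n \<Rightarrow> real ^ 'n \<Rightarrow> bool"  (infix "\<lless>" 50)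
  where "x \<lless> y \<longleftrightarrow> (\<forall>i. x $ i < y $ i)"

definition continuously_differentiable ::
  "('a::real_normed_vector \<Rightarrow> 'b::real_normed_vector) \<Rightarrow> bool"
  where "continuously_differentiable g \<longleftrightarrow>
    (\<exists>g'. (\<forall>z. (g has_derivative blinfun_apply (g' z)) (at z)) \<and> continuous_on UNIV g')"

text \<open>
  The usual epsilon-delta definition; a finite family of non-overlapping closed intervals is
  a division of its own union.
\<close>

definition absolutely_continuous_on :: "real set \<Rightarrow> (real \<Rightarrow> 'a::real_normed_vector) \<Rightarrow> bool"
  where "absolutely_continuous_on S g \<longleftrightarrow>
    (\<forall>\<epsilon>>0. \<exists>\<delta>>0. \<forall>d. d division_of (\<Union>d) \<and> \<Union>d \<subseteq> S \<and> (\<Sum>k\<in>d. Sup k - Inf k) < \<delta>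
       \<longrightarrow> (\<Sum>k\<in>d. norm (g (Sup k) - g (Inf k))) < \<epsilon>)"

text \<open>
  Inputs are total functions on \<^typ>\<open>real\<close>; only their values on the nonnegative half-line,
  or on the horizon in question, are ever used.
\<close>

definition Linf_loc :: "(real \<Rightarrow> real ^ 'm) set"
  where "Linf_loc =
    {u. u \<in> borel_measurable (lebesgue_on {0..}) \<and>
        (\<forall>T>0. \<exists>B. AE t in lebesgue_on {0..T}. norm (u t) \<le> B)}"

text \<open>
  At each of the finitely many jumps the value is one of the two one-sided limits, so that
  single-point jumps are excluded and the function is continuous at both end points. Since
  constraints are imposed pointwise, isolated values would matter: the value at the final
  time alone could make an active constraint look inactive.
\<close>

definition piecewise_continuous :: "real \<Rightarrow> real \<Rightarrow> (real \<Rightarrow> 'a::topological_space) \<Rightarrow> bool"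
  where "piecewise_continuous a b u \<longleftrightarrow>
    finite {t \<in> {a..b}. \<not> continuous (at t within {a..b}) u} \<and>
    (\<forall>t\<in>{a<..b}. \<exists>l. (u \<longlongrightarrow> l) (at_left t)) \<and>
    (\<forall>t\<in>{a..<b}. \<exists>l. (u \<longlongrightarrow> l) (at_right t)) \<and>
    (\<forall>t\<in>{a..b}. (a < t \<and> (u \<longlongrightarrow> u t) (at_left t)) \<or> (t < b \<and> (u \<longlongrightarrow> u t) (at_right t)))"

definition trajectory ::
  "((real ^ 'n) \<times> (real ^ 'm) \<Rightarrow> real ^ 'n) \<Rightarrow> real \<Rightarrow> (real \<Rightarrow> real ^ 'm) \<Rightarrow> (real \<Rightarrow> real ^ 'n) \<Rightarrow> bool"
  where "trajectory f \<tau> u x \<longleftrightarrow>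
    absolutely_continuous_on {0..\<tau>} x \<and>
    (AE t in lebesgue_on {0..\<tau>}. (x has_vector_derivative f (x t, u t)) (at t within {0..\<tau>}))"

definition well_posed :: "((real ^ 'n) \<times> (real ^ 'm) \<Rightarrow> real ^ 'n) \<Rightarrow> bool"
  where "well_posed f \<longleftrightarrow>
    (\<forall>\<tau>>0. \<forall>\<xi>. \<forall>u\<in>Linf_loc.
       (\<exists>x. trajectory f \<tau> u x \<and> x 0 = \<xi>) \<and>
       (\<forall>x y. trajectory f \<tau> u x \<and> x 0 = \<xi> \<and> trajectory f \<tau> u y \<and> y 0 = \<xi>
          \<longrightarrow> (\<forall>t\<in>{0..\<tau>}. x t = y t)))"

text \<open>The value \<open>x(t; \<xi>, u)\<close>, meaningful for \<open>t \<ge> 0\<close> when \<^term>\<open>well_posed f\<close> holds.\<close>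

definition state ::
  "((real ^ 'n) \<times> (real ^ 'm) \<Rightarrow> real ^ 'n) \<Rightarrow> real \<Rightarrow> real ^ 'n \<Rightarrow> (real \<Rightarrow> real ^ 'm) \<Rightarrow> real ^ 'n"
  where "state f t \<xi> u = (THE y. \<exists>x. trajectory f t u x \<and> x 0 = \<xi> \<and> x t = y)"

definition monotone_control_system :: "((real ^ 'n) \<times> (real ^ 'm) \<Rightarrow> real ^ 'n) \<Rightarrow> bool"
  where "monotone_control_system f \<longleftrightarrow>
    (\<forall>t\<ge>0. \<forall>\<xi>\<^sub>1 \<xi>\<^sub>2. \<forall>u\<^sub>1\<in>Linf_loc. \<forall>u\<^sub>2\<in>Linf_loc.
       \<xi>\<^sub>1 \<le> \<xi>\<^sub>2 \<and> (AE t in lebesgue_on {0..}. u\<^sub>1 t \<le> u\<^sub>2 t)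
         \<longrightarrow> state f t \<xi>\<^sub>1 u\<^sub>1 \<le> state f t \<xi>\<^sub>2 u\<^sub>2)"

definition excitable :: "((real ^ 'n) \<times> (real ^ 'm) \<Rightarrow> real ^ 'n) \<Rightarrow> bool"
  where "excitable f \<longleftrightarrow>
    (\<forall>\<xi>. \<forall>u\<^sub>1\<in>Linf_loc. \<forall>u\<^sub>2\<in>Linf_loc.
       (AE t in lebesgue_on {0..}. u\<^sub>1 t < u\<^sub>2 t)
         \<longrightarrow> (\<forall>t>0. state f t \<xi> u\<^sub>1 \<lless> state f t \<xi> u\<^sub>2))"

definition admissible ::
  "((real ^ 'n) \<times> (real ^ 'm) \<Rightarrow> real ^ 'n) \<Rightarrow> ((real ^ 'n) \<times> (real ^ 'm) \<Rightarrow> real ^ 's) \<Rightarrow> real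
    \<Rightarrow> (real \<Rightarrow> real ^ 'm) \<Rightarrow> (real \<Rightarrow> real ^ 'n) \<Rightarrow> bool"
  where "admissible f h t\<^sub>f u x \<longleftrightarrow> trajectory f t\<^sub>f u x \<and> (\<forall>t\<in>{0..t\<^sub>f}. 0 \<le> h (x t, u t))"

definition cost ::
  "((real ^ 'n) \<times> (real ^ 'm) \<Rightarrow> real ^ 'n) \<Rightarrow> ((real ^ 'n) \<times> (real ^ 'm) \<Rightarrow> real) \<Rightarrow> real
    \<Rightarrow> real ^ 'n \<Rightarrow> (real \<Rightarrow> real ^ 'm) \<Rightarrow> real"
  where "cost f L t\<^sub>f \<xi> u = integral {0..t\<^sub>f} (\<lambda>t. L (state f t \<xi> u, u t))"

definition optimal ::
  "((real ^ 'n) \<times> (real ^ 'm) \<Rightarrow> real ^ 'n) \<Rightarrow> ((real ^ 'n) \<times> (real ^ 'm) \<Rightarrow> real)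
    \<Rightarrow> ((real ^ 'n) \<times> (real ^ 'm) \<Rightarrow> real ^ 's) \<Rightarrow> real
    \<Rightarrow> real ^ 'n \<Rightarrow> (real \<Rightarrow> real ^ 'm) \<Rightarrow> (real \<Rightarrow> real ^ 'n) \<Rightarrow> bool"
  where "optimal f L h t\<^sub>f \<xi> u x \<longleftrightarrow>
    piecewise_continuous 0 t\<^sub>f u \<and> admissible f h t\<^sub>f u x \<and> x 0 = \<xi> \<and>
    (\<forall>v y. piecewise_continuous 0 t\<^sub>f v \<and> admissible f h t\<^sub>f v y \<and> y 0 = \<xi>
       \<longrightarrow> cost f L t\<^sub>f \<xi> v \<le> cost f L t\<^sub>f \<xi> u)"

end

theory Submission
  imports Defs
begin

text \<open>
  The idea is to raise the input slightly just before the final time. Since \<open>h (x t\<^sub>f, u t\<^sub>f)\<close> is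
  strictly positive and \<open>h\<close> is continuous, there is \<open>r > 0\<close> such that \<open>h\<close> stays nonnegative at all
  pairs within \<open>r\<close> of \<open>x t\<^sub>f\<close> and \<open>u t\<^sub>f\<close> (lemma \<open>uniformly_positive_near\<close>). Let \<open>e\<close> have positive
  entries and norm less than \<open>r / 2\<close>, and let \<open>v\<close> equal \<open>u\<close> before a time \<open>s\<close> and \<open>u + e\<close> from \<open>s\<close>
  on. For \<open>s\<close> close to \<open>t\<^sub>f\<close>, both \<open>u\<close> and \<open>x\<close> stay within \<open>r / 2\<close> of their final values on
  \<open>[s, t\<^sub>f]\<close> (lemma \<open>late_interval\<close>).

  The trajectory \<open>y\<close> of \<open>v\<close> agrees with \<open>x\<close> up to \<open>s\<close>, and afterwards it stays close to \<open>x t\<^sub>f\<close>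
  simply because little time is left: the field \<open>f\<close> is bounded by some \<open>M\<close> near
  \<open>(x t\<^sub>f, u t\<^sub>f)\<close>, and \<open>s\<close> can be chosen with \<open>M * (t\<^sub>f - s) < r / 2\<close> (lemma
  \<open>absolutely_continuous_on_trapped\<close>). Hence \<open>(v, y)\<close> is admissible.

  It remains to see that the cost has increased. Monotonicity gives \<open>x \<le> y\<close>, so the running cost of
  \<open>(v, y)\<close> is nowhere below that of \<open>(u, x)\<close>. At the final time it is strictly larger: if \<open>L\<close>
  increases strictly with the input, because \<open>u t\<^sub>f < v t\<^sub>f\<close>; if the system is excitable, because
  excitability, applied to the trajectories restarted at time \<open>s\<close>, makes all components of \<open>y t\<^sub>f\<close>
  larger than those of \<open>x t\<^sub>f\<close>. Both running costs are continuous on \<open>[s, t\<^sub>f]\<close>, so the strict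
  inequality persists on an interval and shows in the integral (lemma
  \<open>integral_less_if_less_at_right_end\<close>).
\<close>

section \<open>Absolutely continuous curves\<close>

lemma AE_lebesgue_on_iff_negligible:
  fixes S :: "'a::euclidean_space set"
  assumes "S \<in> sets lebesgue"
  shows "(AE t in lebesgue_on S. P t) \<longleftrightarrow> negligible {t \<in> S. \<not> P t}"
proof -
  have "(AE t in lebesgue_on S. P t) \<longleftrightarrow> (AE t in lebesgue. t \<in> S \<longrightarrow> P t)"
    by (rule AE_restrict_space_iff) (use assms in simp)
  also have "\<dots> \<longleftrightarrow> negligible {t \<in> S. \<not> P t}"
    unfolding eventually_ae_filter_negligible by (auto intro: negligible_subset)
  finally show ?thesis .
qed

lemma division_of_real_memE:
  fixes d :: "real set set"
  assumes "d division_of S" "k \<in> d"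
  obtains a b where "k = {a..b}" "a \<le> b"
proof -
  obtain a b where "k = cbox a b" using division_ofD(4)[OF assms] by blast
  moreover have "k \<noteq> {}" using division_ofD(3)[OF assms] .
  ultimately show thesis using that[of a b] by simp
qed

text \<open>
  The intervals of a division overlap only in their end points, so their lengths add up to the
  measure of their union.
\<close>

lemma sum_length_division_le_measure:
  fixes d :: "real set set"
  assumes "d division_of \<Union>d" "\<Union>d \<subseteq> U" "U \<in> lmeasurable"
  shows "(\<Sum>k\<in>d. Sup k - Inf k) \<le> measure lebesgue U"
proof -
  have "(\<Sum>k\<in>d. Sup k - Inf k) = (\<Sum>k\<in>d. measure lebesgue k)"
  proof (rule sum.cong)
    fix k assume "k \<in> d"
    with assms(1) obtain a b where "k = {a..b}" "a \<le> b"
      by (rule division_of_real_memE)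
    then show "Sup k - Inf k = measure lebesgue k" by simp
  qed simp
  also have "\<dots> = measure lebesgue (\<Union>d)"
  proof (rule measure_negligible_finite_Union[symmetric])
    show "finite d" using assms(1) by blast
    show "k \<in> lmeasurable" if "k \<in> d" for k
      using division_of_real_memE[OF assms(1) that] by (metis lmeasurable_cbox box_real(2))
    show "pairwise (\<lambda>k l. negligible (k \<inter> l)) d"
      unfolding pairwise_def
    proof (intro ballI impI)
      fix k l assume kl: "k \<in> d" "l \<in> d" "k \<noteq> l"
      obtain p q p' q' where "k = cbox p q" "l = cbox p' q'"
        using division_ofD(4)[OF assms(1)] kl(1,2) by blast
      then have "convex (k \<inter> l)" by (simp add: convex_Int)
      moreover have "interior (k \<inter> l) = {}"
        using division_ofD(5)[OF assms(1) kl] by simp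
      ultimately show "negligible (k \<inter> l)"
        by (simp add: negligible_convex_interior)
    qed
  qed
  also have "\<dots> \<le> measure lebesgue U"
    using assms(2) fmeasurableD[OF lmeasurable_division[OF assms(1)]] assms(3)
    by (rule measure_mono_fmeasurable)
  finally show ?thesis .
qed

lemma absolutely_continuous_onE:
  assumes "absolutely_continuous_on S g" "0 < \<epsilon>"
  obtains \<delta> where "0 < \<delta>"
    and "\<forall>d. d division_of (\<Union>d) \<and> \<Union>d \<subseteq> S \<and> (\<Sum>k\<in>d. Sup k - Inf k) < \<delta>
      \<longrightarrow> (\<Sum>k\<in>d. norm (g (Sup k) - g (Inf k))) < \<epsilon>"
  using assms unfolding absolutely_continuous_on_def by blast

lemma absolutely_continuous_on_subset:
  assumes "absolutely_continuous_on S g" "T \<subseteq> S"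
  shows "absolutely_continuous_on T g"
  unfolding absolutely_continuous_on_def
proof (intro allI impI)
  fix \<epsilon> :: real assume "0 < \<epsilon>"
  obtain \<delta> where "0 < \<delta>" and \<delta>: "\<forall>d. d division_of (\<Union>d) \<and> \<Union>d \<subseteq> S \<and>
      (\<Sum>k\<in>d. Sup k - Inf k) < \<delta> \<longrightarrow> (\<Sum>k\<in>d. norm (g (Sup k) - g (Inf k))) < \<epsilon>"
    using absolutely_continuous_onE[OF assms(1) \<open>0 < \<epsilon>\<close>] .
  show "\<exists>\<delta>>0. \<forall>d. d division_of (\<Union>d) \<and> \<Union>d \<subseteq> T \<and> (\<Sum>k\<in>d. Sup k - Inf k) < \<delta>
       \<longrightarrow> (\<Sum>k\<in>d. norm (g (Sup k) - g (Inf k))) < \<epsilon>"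
    by (intro exI[of _ \<delta>] conjI allI impI \<open>0 < \<delta>\<close> \<delta>[rule_format]) (use assms(2) in auto)
qed

lemma absolutely_continuous_on_imp_continuous_on:
  assumes "absolutely_continuous_on {a..b} g"
  shows "continuous_on {a..b} g"
  unfolding continuous_on_iff
proof (intro ballI allI impI)
  fix t \<epsilon> :: real assume t: "t \<in> {a..b}" and "0 < \<epsilon>"
  obtain \<delta> where "0 < \<delta>" and \<delta>: "\<forall>d. d division_of (\<Union>d) \<and> \<Union>d \<subseteq> {a..b} \<and>
      (\<Sum>k\<in>d. Sup k - Inf k) < \<delta> \<longrightarrow> (\<Sum>k\<in>d. norm (g (Sup k) - g (Inf k))) < \<epsilon>"
    using absolutely_continuous_onE[OF assms \<open>0 < \<epsilon>\<close>] .
  have *: "norm (g q - g p) < \<epsilon>" if "a \<le> p" "p \<le> q" "q \<le> b" "q - p < \<delta>" for p q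
    using \<delta>[rule_format, of "{{p..q}}"] division_of_self[of p q] that by simp
  show "\<exists>\<delta>>0. \<forall>r\<in>{a..b}. dist r t < \<delta> \<longrightarrow> dist (g r) (g t) < \<epsilon>"
  proof (intro exI conjI ballI impI)
    fix r assume "r \<in> {a..b}" "dist r t < \<delta>"
    then show "dist (g r) (g t) < \<epsilon>"
      using *[of r t] *[of t r] t by (cases "r \<le> t") (auto simp: dist_norm norm_minus_commute)
  qed (fact \<open>\<delta> > 0\<close>)
qed

text \<open>
  Excitability speaks about inputs that differ from time \<open>0\<close> on, whereas the inputs compared
  below differ only from a later time \<open>s\<close> on. Moving \<open>s\<close> to the origin bridges this gap.
\<close>

lemma absolutely_continuous_on_translation:
  assumes "absolutely_continuous_on {a..b} g"
  shows "absolutely_continuous_on {a - c..b - c} (\<lambda>t. g (c + t))"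
  unfolding absolutely_continuous_on_def
proof (intro allI impI)
  fix \<epsilon> :: real assume "0 < \<epsilon>"
  obtain \<delta> where "0 < \<delta>" and \<delta>: "\<forall>d. d division_of (\<Union>d) \<and> \<Union>d \<subseteq> {a..b} \<and>
      (\<Sum>k\<in>d. Sup k - Inf k) < \<delta> \<longrightarrow> (\<Sum>k\<in>d. norm (g (Sup k) - g (Inf k))) < \<epsilon>"
    using absolutely_continuous_onE[OF assms \<open>0 < \<epsilon>\<close>] .
  show "\<exists>\<delta>>0. \<forall>d. d division_of (\<Union>d) \<and> \<Union>d \<subseteq> {a - c..b - c} \<and> (\<Sum>k\<in>d. Sup k - Inf k) < \<delta>
       \<longrightarrow> (\<Sum>k\<in>d. norm (g (c + Sup k) - g (c + Inf k))) < \<epsilon>"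
  proof (intro exI conjI allI impI; (elim conjE)?)
    fix d :: "real set set"
    assume d: "d division_of (\<Union>d)" and sub: "\<Union>d \<subseteq> {a - c..b - c}"
      and len: "(\<Sum>k\<in>d. Sup k - Inf k) < \<delta>"
    let ?T = "\<lambda>k. (+) c ` k"
    have inj: "inj_on ?T d"
      by (rule inj_onI) (simp add: inj_image_eq_iff)
    have ends: "Sup (?T k) = c + Sup k" "Inf (?T k) = c + Inf k" if kd: "k \<in> d" for k
    proof -
      obtain p q where "k = {p..q}" "p \<le> q"
        using division_of_real_memE[OF d kd] .
      then show "Sup (?T k) = c + Sup k" "Inf (?T k) = c + Inf k" by simp_all
    qed
    have "?T ` d division_of (\<Union>(?T ` d))"
    proof (rule division_ofI)
      show "finite (?T ` d)" using division_of_finite[OF d] by simp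
      fix K assume "K \<in> ?T ` d"
      then obtain k where k: "k \<in> d" "K = ?T k" by auto
      obtain p q where "k = {p..q}" "p \<le> q"
        using division_of_real_memE[OF d k(1)] .
      then show "K \<noteq> {}" "\<exists>a b. K = cbox a b" by (auto simp: k)
      show "K \<subseteq> \<Union>(?T ` d)" using k by blast
      fix K' assume "K' \<in> ?T ` d" "K \<noteq> K'"
      then obtain k' where k': "k' \<in> d" "K' = ?T k'" "k \<noteq> k'" using k by auto
      have "interior k \<inter> interior k' = {}"
        using division_ofD(5)[OF d] k k' by blast
      then show "interior K \<inter> interior K' = {}"
        by (auto simp: k k' interior_translation)
    qed simp
    then have "(\<Sum>k\<in>?T ` d. norm (g (Sup k) - g (Inf k))) < \<epsilon>"
    proof (intro \<delta>[rule_format] conjI)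
      show "\<Union>(?T ` d) \<subseteq> {a..b}" using sub by fastforce
      show "(\<Sum>k\<in>?T ` d. Sup k - Inf k) < \<delta>"
        using len by (simp add: sum.reindex[OF inj] ends)
    qed
    then show "(\<Sum>k\<in>d. norm (g (c + Sup k) - g (c + Inf k))) < \<epsilon>"
      by (simp add: sum.reindex[OF inj] ends)
  qed (fact \<open>\<delta> > 0\<close>)
qed

text \<open>
  The mean value inequality for absolutely continuous curves. Take a tagged division fine for a
  suitable gauge. An interval tagged outside \<open>N\<close> contributes at most \<open>M + \<eta>\<close> times its length, by
  differentiability at the tag. The intervals tagged in \<open>N\<close> lie in an open set of measure less
  than the \<open>\<delta>\<close> that absolute continuity assigns to \<open>\<eta>\<close>, so together they contribute at most \<open>\<eta>\<close>.
\<close>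

lemma absolutely_continuous_on_norm_diff_le:
  fixes g :: "real \<Rightarrow> 'a::real_normed_vector"
  assumes "a \<le> b" and ac: "absolutely_continuous_on {a..b} g" and "negligible N" and "0 \<le> M"
    and deriv: "\<And>t. t \<in> {a..b} - N \<Longrightarrow>
      \<exists>D. (g has_vector_derivative D) (at t within {a..b}) \<and> norm D \<le> M"
  shows "norm (g b - g a) \<le> M * (b - a)"
proof -
  have approx: "norm (g b - g a) \<le> \<eta> + (M + \<eta>) * (b - a)" if "0 < \<eta>" for \<eta>
  proof -
    obtain \<delta> where "0 < \<delta>" and \<delta>: "\<forall>d. d division_of (\<Union>d) \<and> \<Union>d \<subseteq> {a..b} \<and>
        (\<Sum>k\<in>d. Sup k - Inf k) < \<delta> \<longrightarrow> (\<Sum>k\<in>d. norm (g (Sup k) - g (Inf k))) < \<eta>"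
      using absolutely_continuous_onE[OF ac \<open>0 < \<eta>\<close>] .
    obtain U where U: "open U" "N \<subseteq> U" "U \<in> lmeasurable" "measure lebesgue U < \<delta>"
    proof -
      have N: "N \<in> lmeasurable" "measure lebesgue N = 0"
        using \<open>negligible N\<close> by (simp_all add: negligible_imp_measurable negligible_imp_measure0)
      obtain U where U: "open U" "N \<subseteq> U" "U - N \<in> lmeasurable" "emeasure lebesgue (U - N) < ennreal \<delta>"
        using sets_lebesgue_outer_open[OF fmeasurableD[OF N(1)] \<open>0 < \<delta>\<close>] .
      have eq: "U = N \<union> (U - N)" using U(2) by blast
      have "U \<in> lmeasurable" by (subst eq) (intro fmeasurable.Un N U)
      moreover have "measure lebesgue U \<le> measure lebesgue N + measure lebesgue (U - N)"
        by (subst eq) (intro measure_Un_le fmeasurableD N U)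
      moreover have "measure lebesgue (U - N) < \<delta>"
        using U(3,4) \<open>0 < \<delta>\<close> by (simp add: emeasure_eq_measure2 ennreal_less_iff)
      ultimately show thesis using that[of U] U(1,2) N(2) by linarith
    qed
    \<comment> \<open>The radii of the gauge: inside \<open>U\<close> at tags in \<open>N\<close>, within reach of the derivative elsewhere.\<close>
    have "\<exists>r>0. (t \<in> N \<longrightarrow> ball t r \<subseteq> U) \<and> (t \<in> {a..b} - N \<longrightarrow>
        (\<forall>p\<in>{a..b}. \<bar>p - t\<bar> < r \<longrightarrow> norm (g p - g t) \<le> (M + \<eta>) * \<bar>p - t\<bar>))" for t
    proof (cases "t \<in> {a..b} - N")
      case True
      then obtain D where D: "(g has_vector_derivative D) (at t within {a..b})" "norm D \<le> M"
        using deriv by blast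
      then obtain r where r: "r > 0" and
        rD: "\<forall>p\<in>{a..b}. norm (p - t) < r \<longrightarrow> norm (g p - g t - (p - t) *\<^sub>R D) \<le> \<eta> * norm (p - t)"
        using \<open>0 < \<eta>\<close> unfolding has_vector_derivative_def has_derivative_within_alt by blast
      have "norm (g p - g t) \<le> (M + \<eta>) * \<bar>p - t\<bar>" if "p \<in> {a..b}" "\<bar>p - t\<bar> < r" for p
      proof -
        have "norm (g p - g t) \<le> norm (g p - g t - (p - t) *\<^sub>R D) + norm ((p - t) *\<^sub>R D)"
          using norm_triangle_ineq[of "g p - g t - (p - t) *\<^sub>R D" "(p - t) *\<^sub>R D"] by simp
        also have "\<dots> \<le> \<eta> * \<bar>p - t\<bar> + \<bar>p - t\<bar> * M"
          using rD that D(2) by (intro add_mono) (auto intro!: mult_left_mono)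
        finally show ?thesis by (simp add: algebra_simps)
      qed
      then show ?thesis using r True by blast
    next
      case False
      show ?thesis
      proof (cases "t \<in> N")
        case True
        then have "t \<in> U" using U(2) by blast
        then show ?thesis using False U(1) open_contains_ball by blast
      next
        case F: False
        show ?thesis by (rule exI[of _ 1]) (use F False in auto)
      qed
    qed
    then obtain r where r: "\<And>t. r t > 0" "\<And>t. t \<in> N \<Longrightarrow> ball t (r t) \<subseteq> U"
      "\<And>t p. t \<in> {a..b} - N \<Longrightarrow> p \<in> {a..b} \<Longrightarrow> \<bar>p - t\<bar> < r t \<Longrightarrow> norm (g p - g t) \<le> (M + \<eta>) * \<bar>p - t\<bar>"
      by metis
    obtain p where p: "p tagged_division_of {a..b}" and fine: "(\<lambda>t. ball t (r t)) fine p"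
      using fine_division_exists_real[OF gauge_ball_dependent] r(1) by metis
    have fin: "finite p" using p by blast
    have mem: "\<exists>q q'. K = {q..q'} \<and> q \<le> t \<and> t \<le> q' \<and> a \<le> q \<and> q' \<le> b \<and> \<bar>q - t\<bar> < r t \<and> \<bar>q' - t\<bar> < r t
       \<and> {q..q'} \<subseteq> ball t (r t)" if tK: "(t, K) \<in> p" for t K
    proof -
      obtain q q' where K: "K = {q..q'}"
        using tagged_division_ofD(4)[OF p tK] by auto
      have "t \<in> K" "K \<subseteq> {a..b}" using tagged_division_ofD(2,3)[OF p tK] .
      moreover have sub: "K \<subseteq> ball t (r t)" using fine tK by (auto simp: fine_def)
      moreover have "q \<in> K" "q' \<in> K" using \<open>t \<in> K\<close> by (auto simp: K)
      then have "q \<in> ball t (r t)" "q' \<in> ball t (r t)" using sub by blast+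
      ultimately show ?thesis by (intro exI[of _ q] exI[of _ q']) (auto simp: K dist_real_def)
    qed
    define G where "G = (\<lambda>(t::real, K). norm (g (Sup K) - g (Inf K)))"
    define p1 where "p1 = {x \<in> p. fst x \<in> N}"
    define p2 where "p2 = {x \<in> p. fst x \<notin> N}"
    have "norm (g b - g a) = norm (\<Sum>(t,K)\<in>p. g (Sup K) - g (Inf K))"
      using additive_tagged_division_1[OF \<open>a \<le> b\<close> p, of g] by simp
    also have "\<dots> \<le> (\<Sum>x\<in>p. G x)"
      by (rule sum_norm_le) (auto simp: G_def)
    also have "\<dots> = (\<Sum>x\<in>p1. G x) + (\<Sum>x\<in>p2. G x)"
      unfolding p1_def p2_def using fin
      by (subst sum.union_disjoint[symmetric]) (auto intro!: sum.cong)
    also have "(\<Sum>x\<in>p1. G x) \<le> \<eta>"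
    proof -
      have part: "p1 tagged_partial_division_of {a..b}"
        using p tagged_partial_division_subset[of p _ p1]
        unfolding tagged_division_of_def p1_def by auto
      \<comment> \<open>Absolute continuity sums over intervals, not over tagged intervals. On the real line two
        tags can only share an interval that is a single point, and then they coincide.\<close>
      have inj: "inj_on snd p1"
      proof (rule inj_onI)
        fix x y assume xy: "x \<in> p1" "y \<in> p1" "snd x = snd y"
        obtain t K t' where tK: "x = (t, K)" "y = (t', K)" using xy(3) by (metis prod.collapse)
        have in_p: "(t, K) \<in> p" "(t', K) \<in> p" using xy by (auto simp: p1_def tK)
        show "x = y"
        proof (rule ccontr)
          assume "x \<noteq> y"
          then have "interior K = {}"
            using tagged_division_ofD(5)[OF p in_p] by (auto simp: tK)
          then show False using mem[OF in_p(1)] mem[OF in_p(2)] \<open>x \<noteq> y\<close> 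
            by (auto simp: tK Icc_eq_Icc)
        qed
      qed
      have "snd ` p1 division_of \<Union>(snd ` p1)"
        by (rule partial_division_of_tagged_division[OF part])
      moreover have "\<Union>(snd ` p1) \<subseteq> {a..b}"
        using tagged_partial_division_ofD(3)[OF part] by fastforce
      moreover have "(\<Sum>K\<in>snd ` p1. Sup K - Inf K) < \<delta>"
      proof -
        have "\<Union>(snd ` p1) \<subseteq> U"
          using r(2) fine unfolding p1_def fine_def by fastforce
        from sum_length_division_le_measure[OF calculation(1) this U(3)] U(4)
        show ?thesis by linarith
      qed
      ultimately have "(\<Sum>K\<in>snd ` p1. norm (g (Sup K) - g (Inf K))) < \<eta>"
        using \<delta> by blast
      then show ?thesis
        by (simp add: sum.reindex[OF inj] G_def case_prod_unfold)
    qed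
    also have "(\<Sum>x\<in>p2. G x) \<le> (\<Sum>(t,K)\<in>p2. (M + \<eta>) * (Sup K - Inf K))"
    proof (rule sum_mono, clarify)
      fix t K assume "(t, K) \<in> p2"
      then have tK: "(t, K) \<in> p" "t \<notin> N" by (auto simp: p2_def)
      obtain q q' where q: "K = {q..q'}" "q \<le> t" "t \<le> q'" "a \<le> q" "q' \<le> b" "\<bar>q - t\<bar> < r t" "\<bar>q' - t\<bar> < r t"
        using mem[OF tK(1)] by blast
      have "norm (g q' - g q) \<le> norm (g q' - g t) + norm (g q - g t)"
        by (metis norm_triangle_ineq4 diff_diff_eq2 diff_add_cancel)
      also have "\<dots> \<le> (M + \<eta>) * \<bar>q' - t\<bar> + (M + \<eta>) * \<bar>q - t\<bar>"
        using q tK(2) by (intro add_mono r(3)) auto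
      also have "\<dots> = (M + \<eta>) * (q' - q)"
        using q by (simp add: algebra_simps)
      finally show "G (t, K) \<le> (M + \<eta>) * (Sup K - Inf K)"
        using q by (simp add: G_def)
    qed
    also have "\<dots> \<le> (\<Sum>(t,K)\<in>p. (M + \<eta>) * (Sup K - Inf K))"
    proof (rule sum_mono2)
      fix x assume "x \<in> p - p2"
      then obtain t K where x: "x = (t, K)" "(t, K) \<in> p" by (cases x) auto
      from mem[OF x(2)] have "Inf K \<le> Sup K" by auto
      then show "0 \<le> (case x of (t, K) \<Rightarrow> (M + \<eta>) * (Sup K - Inf K))"
        using \<open>0 \<le> M\<close> \<open>0 < \<eta>\<close> by (simp add: x)
    qed (use fin in \<open>auto simp: p2_def\<close>)
    also have "\<dots> = (M + \<eta>) * (\<Sum>(t,K)\<in>p. Sup K - Inf K)"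
      by (simp add: sum_distrib_left case_prod_unfold)
    also have "\<dots> = (M + \<eta>) * (b - a)"
      using additive_tagged_division_1[OF \<open>a \<le> b\<close> p, of "\<lambda>t. t"] by simp
    finally show ?thesis by simp
  qed
  show ?thesis
  proof (rule field_le_epsilon)
    fix \<epsilon> :: real assume "0 < \<epsilon>"
    define \<eta> where "\<eta> = \<epsilon> / (1 + (b - a))"
    have \<eta>: "0 < \<eta>" "\<eta> * (1 + (b - a)) = \<epsilon>"
      using \<open>0 < \<epsilon>\<close> \<open>a \<le> b\<close> by (simp_all add: \<eta>_def)
    have "norm (g b - g a) \<le> M * (b - a) + \<eta> * (1 + (b - a))"
      using approx[OF \<eta>(1)] by (simp add: algebra_simps)
    then show "norm (g b - g a) \<le> M * (b - a) + \<epsilon>"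
      by (simp only: \<eta>(2))
  qed
qed

text \<open>
  A curve that starts at \<open>y s\<close> and has speed at most \<open>M\<close> while it is within \<open>\<rho>\<close> of \<open>y s\<close> cannot
  travel the distance \<open>\<rho>\<close> when \<open>M\<close> times the available time is less than \<open>\<rho>\<close>:
  apply the mean value inequality up to the first time at which that distance is reached.
\<close>

lemma absolutely_continuous_on_trapped:
  fixes y :: "real \<Rightarrow> 'a::real_normed_vector"
  assumes ac: "absolutely_continuous_on {s..T} y" and "negligible N" and "0 \<le> M"
    and short: "M * (T - s) < \<rho>"
    and deriv: "\<And>t. t \<in> {s..T} - N \<Longrightarrow> dist (y t) (y s) < \<rho> \<Longrightarrow>
      \<exists>D. (y has_vector_derivative D) (at t within {s..T}) \<and> norm D \<le> M"
    and t: "t \<in> {s..T}"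
  shows "dist (y t) (y s) < \<rho>"
proof (rule ccontr)
  assume "\<not> dist (y t) (y s) < \<rho>"
  define E where "E = {s..T} \<inter> (\<lambda>t. dist (y t) (y s)) -` {\<rho>..}"
  have "closed E"
    unfolding E_def using absolutely_continuous_on_imp_continuous_on[OF ac]
    by (intro continuous_closed_preimage continuous_intros) auto
  then have "compact E" by (simp add: E_def compact_eq_bounded_closed bounded_Int)
  have "E \<noteq> {}" using t \<open>\<not> dist (y t) (y s) < \<rho>\<close> by (auto simp: E_def)
  obtain t1 where t1: "t1 \<in> E" and least: "\<And>r. r \<in> E \<Longrightarrow> t1 \<le> r"
    using compact_attains_inf[OF \<open>compact E\<close> \<open>E \<noteq> {}\<close>] by metis
  have t1': "s \<le> t1" "t1 \<le> T" "\<rho> \<le> dist (y t1) (y s)" using t1 by (auto simp: E_def)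
  have "norm (y t1 - y s) \<le> M * (t1 - s)"
  proof (rule absolutely_continuous_on_norm_diff_le)
    show "absolutely_continuous_on {s..t1} y"
      using absolutely_continuous_on_subset[OF ac] t1' by simp
    \<comment> \<open>The speed bound is unavailable at the exit time \<open>t1\<close> itself, so \<open>t1\<close> is discarded.\<close>
    show "negligible (insert t1 N)" using \<open>negligible N\<close> by simp
    fix r assume r: "r \<in> {s..t1} - insert t1 N"
    then have "r \<notin> E" using least[of r] by auto
    then have "dist (y r) (y s) < \<rho>" using r t1' by (auto simp: E_def)
    moreover have "r \<in> {s..T} - N" using r t1' by auto
    ultimately obtain D where "(y has_vector_derivative D) (at r within {s..T})" "norm D \<le> M"
      using deriv by blast
    then show "\<exists>D. (y has_vector_derivative D) (at r within {s..t1}) \<and> norm D \<le> M"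
      using has_vector_derivative_within_subset[of y D r "{s..T}" "{s..t1}"] t1' by auto
  qed (use t1' \<open>0 \<le> M\<close> in auto)
  also have "\<dots> \<le> M * (T - s)" using t1' \<open>0 \<le> M\<close> by (intro mult_left_mono) auto
  also have "\<dots> < \<rho>" by (rule short)
  finally show False using t1' by (simp add: dist_norm)
qed

section \<open>Trajectories and states\<close>

lemma trajectory_iff:
  "trajectory f \<tau> u x \<longleftrightarrow> absolutely_continuous_on {0..\<tau>} x \<and>
    negligible {t \<in> {0..\<tau>}. \<not> (x has_vector_derivative f (x t, u t)) (at t within {0..\<tau>})}"
  unfolding trajectory_def by (simp add: AE_lebesgue_on_iff_negligible)

lemma trajectory_imp_continuous_on:
  "trajectory f \<tau> u x \<Longrightarrow> continuous_on {0..\<tau>} x"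
  unfolding trajectory_def by (elim conjE) (rule absolutely_continuous_on_imp_continuous_on)

lemma trajectory_cong:
  assumes "trajectory f \<tau> u x" "negligible N" "\<And>t. t \<in> {0..\<tau>} - N \<Longrightarrow> u t = w t"
  shows "trajectory f \<tau> w x"
proof -
  let ?B = "\<lambda>u. {t \<in> {0..\<tau>}. \<not> (x has_vector_derivative f (x t, u t)) (at t within {0..\<tau>})}"
  have "negligible (?B u \<union> N)"
    using assms(1,2) by (simp add: trajectory_iff)
  moreover have "?B w \<subseteq> ?B u \<union> N" using assms(3) by auto
  ultimately have "negligible (?B w)" by (rule negligible_subset)
  then show ?thesis using assms(1) by (simp add: trajectory_iff)
qed

lemma trajectory_restrict:
  assumes "trajectory f \<tau> u x" "\<sigma> \<le> \<tau>"
  shows "trajectory f \<sigma> u x"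
proof -
  let ?B = "\<lambda>\<tau>. {t \<in> {0..\<tau>}. \<not> (x has_vector_derivative f (x t, u t)) (at t within {0..\<tau>})}"
  have "?B \<sigma> \<subseteq> ?B \<tau>"
    using has_vector_derivative_within_subset[of x _ _ "{0..\<tau>}" "{0..\<sigma>}"] assms(2) by auto
  then have "negligible (?B \<sigma>)"
    using assms(1) negligible_subset unfolding trajectory_iff by blast
  then show ?thesis
    using assms absolutely_continuous_on_subset[of "{0..\<tau>}" x "{0..\<sigma>}"] by (simp add: trajectory_iff)
qed

lemma trajectory_shift:
  assumes "trajectory f \<tau> u x" "0 \<le> s"
  shows "trajectory f (\<tau> - s) (\<lambda>t. u (s + t)) (\<lambda>t. x (s + t))"
proof -
  let ?B = "{t \<in> {0..\<tau>}. \<not> (x has_vector_derivative f (x t, u t)) (at t within {0..\<tau>})}"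
  let ?C = "{t \<in> {0..\<tau> - s}.
    \<not> ((\<lambda>t. x (s + t)) has_vector_derivative f (x (s + t), u (s + t))) (at t within {0..\<tau> - s})}"
  have "?C \<subseteq> (+) (- s) ` ?B"
  proof
    fix t assume t: "t \<in> ?C"
    have "s + t \<in> ?B"
    proof (rule ccontr)
      assume "s + t \<notin> ?B"
      then have "(x has_vector_derivative f (x (s + t), u (s + t))) (at (s + t) within {0..\<tau>})"
        using t assms(2) by auto
      then have "(x has_vector_derivative f (x (s + t), u (s + t)))
          (at (s + t) within (+) s ` {0..\<tau> - s})"
        by (rule has_vector_derivative_within_subset) (use assms(2) in auto)
      moreover have "((+) s has_vector_derivative 1) (at t within {0..\<tau> - s})"
        unfolding has_vector_derivative_def by (auto intro!: derivative_eq_intros)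
      ultimately show False
        using vector_diff_chain_within[of "(+) s" 1 t "{0..\<tau> - s}" x] t by (auto simp: o_def)
    qed
    then show "t \<in> (+) (- s) ` ?B" by (rule rev_image_eqI) simp
  qed
  moreover have "negligible ((+) (- s) ` ?B)"
    using assms(1) by (intro negligible_translation) (simp add: trajectory_iff)
  ultimately have "negligible ?C" by (rule negligible_subset[rotated])
  moreover have "absolutely_continuous_on {0..\<tau> - s} (\<lambda>t. x (s + t))"
    using assms absolutely_continuous_on_translation[of "s" \<tau> x s]
      absolutely_continuous_on_subset[of "{0..\<tau>}" x "{s..\<tau>}"] by (simp add: trajectory_iff)
  ultimately show ?thesis by (simp add: trajectory_iff)
qed

lemma trajectory_unique:
  assumes "well_posed f" "w \<in> Linf_loc" "trajectory f \<tau> w x" "trajectory f \<tau> w y" "x 0 = y 0"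
    and "t \<in> {0..\<tau>}"
  shows "x t = y t"
proof (cases "t = 0")
  case False
  with assms(6) have "0 < \<tau>" by simp
  with assms show ?thesis unfolding well_posed_def by blast
qed (use assms(5) in simp)

lemma state_eq:
  assumes wp: "well_posed f" and w: "w \<in> Linf_loc" and x: "trajectory f \<tau> w x"
    and t: "0 \<le> t" "t \<le> \<tau>"
  shows "state f t (x 0) w = x t"
  unfolding state_def
proof (rule the_equality)
  have "trajectory f t w x" using trajectory_restrict[OF x t(2)] .
  then show "\<exists>z. trajectory f t w z \<and> z 0 = x 0 \<and> z t = x t" by blast
  fix y assume "\<exists>z. trajectory f t w z \<and> z 0 = x 0 \<and> z t = y"
  then obtain z where z: "trajectory f t w z" "z 0 = x 0" "z t = y" by blast
  have "z t = x t"
    by (rule trajectory_unique[OF wp w z(1) \<open>trajectory f t w x\<close> z(2)]) (use t in simp)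
  then show "y = x t" using z(3) by simp
qed

text \<open>
  The state at time \<open>t\<close> sees the input on \<open>[0, t]\<close> only. Hence replacing an input after the
  final time by values that put it into \<^const>\<open>Linf_loc\<close> does not change its cost.
\<close>

lemma state_cong:
  assumes "\<And>r. r \<in> {0..t} \<Longrightarrow> u r = w r"
  shows "state f t \<xi> u = state f t \<xi> w"
proof -
  have "trajectory f t u x \<longleftrightarrow> trajectory f t w x" for x
    using trajectory_cong[of f t u x "{}" w] trajectory_cong[of f t w x "{}" u] assms by auto
  then show ?thesis unfolding state_def by simp
qed

section \<open>Piecewise continuous inputs\<close>

text \<open>
  An input on \<open>[0, T]\<close> has arbitrary values after \<open>T\<close>, which may even be non-measurable, whereas
  well-posedness, monotonicity and excitability concern inputs on the whole half-line. Holding the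
  last value turns the former into the latter and preserves the order between inputs.
\<close>

definition hold :: "real \<Rightarrow> (real \<Rightarrow> 'a) \<Rightarrow> real \<Rightarrow> 'a"
  where "hold T u t = u (min t T)"

lemma hold_in_Linf_loc:
  fixes u :: "real \<Rightarrow> real ^ 'm"
  assumes "0 \<le> T" and u: "u \<in> borel_measurable (lebesgue_on {0..T})" and bdd: "bounded (u ` {0..T})"
  shows "hold T u \<in> Linf_loc"
proof -
  let ?g = "\<lambda>t. (if t \<in> {0..T} then u t else 0) + (if t \<in> {0..T} then 0 else u T)"
  have "(\<lambda>t. if t \<in> {0..T} then u t else 0) \<in> borel_measurable lebesgue"
    using u by (rule borel_measurable_if_I) simp
  moreover have "(\<lambda>t. if t \<in> {0..T} then 0 else u T) \<in> borel_measurable lebesgue"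
    by (intro measurable_If_set) auto
  ultimately have "?g \<in> borel_measurable lebesgue"
    by (rule borel_measurable_add)
  then have "?g \<in> borel_measurable (lebesgue_on {0..})"
    by (rule measurable_restrict_space1)
  moreover have "?g t = hold T u t" if "t \<in> space (lebesgue_on {0..})" for t
    using that by (auto simp: hold_def min_def space_restrict_space)
  ultimately have "hold T u \<in> borel_measurable (lebesgue_on {0..})"
    using measurable_cong[of "lebesgue_on {0..}" ?g "hold T u" borel] by blast
  moreover obtain B where B: "\<And>t. t \<in> {0..T} \<Longrightarrow> norm (u t) \<le> B"
    using bdd unfolding bounded_iff by blast
  have "AE t in lebesgue_on {0..\<tau>}. norm (hold T u t) \<le> B" for \<tau>
    by (rule AE_I2) (use B \<open>0 \<le> T\<close> in \<open>auto simp: hold_def space_restrict_space min_def\<close>)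
  ultimately show ?thesis unfolding Linf_loc_def by blast
qed

lemma piecewise_continuousD:
  assumes "piecewise_continuous a b u"
  shows "finite {t \<in> {a..b}. \<not> continuous (at t within {a..b}) u}"
    and "a < t \<Longrightarrow> t \<le> b \<Longrightarrow> \<exists>l. (u \<longlongrightarrow> l) (at_left t)"
    and "a \<le> t \<Longrightarrow> t < b \<Longrightarrow> \<exists>l. (u \<longlongrightarrow> l) (at_right t)"
    and "a \<le> t \<Longrightarrow> t \<le> b \<Longrightarrow>
      (a < t \<and> (u \<longlongrightarrow> u t) (at_left t)) \<or> (t < b \<and> (u \<longlongrightarrow> u t) (at_right t))"
  using assms unfolding piecewise_continuous_def by simp_all

text \<open>
  The one-sided limits bound the function near each point, and Bolzano's bisection principle
  turns these local bounds into a global one.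
\<close>

lemma piecewise_continuous_bounded:
  fixes u :: "real \<Rightarrow> 'a::metric_space"
  assumes pc: "piecewise_continuous a b u"
  shows "bounded (u ` {a..b})"
proof (cases "a \<le> b")
  case True
  then have "bounded (u ` ({a..b} \<inter> {a..b}))"
  proof (induction rule: Bolzano[where P = "\<lambda>p q. bounded (u ` ({p..q} \<inter> {a..b}))"])
    case (trans p q r)
    then have "{p..r} \<inter> {a..b} = {p..q} \<inter> {a..b} \<union> {q..r} \<inter> {a..b}" by auto
    then show ?case using trans by (simp add: image_Un)
  next
    case (local t)
    have "\<exists>c<t. bounded (u ` ({c<..<t} \<inter> {a..b}))"
    proof (cases "a < t")
      case True
      then obtain l where "(u \<longlongrightarrow> l) (at_left t)"
        using piecewise_continuousD(2)[OF pc] local by blast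
      then have "\<forall>\<^sub>F y in at_left t. dist (u y) l < 1" by (rule tendstoD) simp
      then obtain c where "c < t" "\<forall>y>c. y < t \<longrightarrow> dist (u y) l < 1"
        unfolding eventually_at_left_field by blast
      then show ?thesis
        by (intro exI[of _ c] conjI bounded_subset[OF bounded_ball[of l 1]]) (auto simp: dist_commute)
    next
      case False
      then have "{t - 1<..<t} \<inter> {a..b} = {}" by auto
      then show ?thesis by (intro exI[of _ "t - 1"]) simp
    qed
    then obtain c where c: "c < t" "bounded (u ` ({c<..<t} \<inter> {a..b}))" by blast
    have "\<exists>d>t. bounded (u ` ({t<..<d} \<inter> {a..b}))"
    proof (cases "t < b")
      case True
      then obtain l where "(u \<longlongrightarrow> l) (at_right t)"
        using piecewise_continuousD(3)[OF pc] local by blast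
      then have "\<forall>\<^sub>F y in at_right t. dist (u y) l < 1" by (rule tendstoD) simp
      then obtain d where "t < d" "\<forall>y>t. y < d \<longrightarrow> dist (u y) l < 1"
        unfolding eventually_at_right_field by blast
      then show ?thesis
        by (intro exI[of _ d] conjI bounded_subset[OF bounded_ball[of l 1]]) (auto simp: dist_commute)
    next
      case False
      then have "{t<..<t + 1} \<inter> {a..b} = {}" by auto
      then show ?thesis by (intro exI[of _ "t + 1"]) simp
    qed
    then obtain d where d: "t < d" "bounded (u ` ({t<..<d} \<inter> {a..b}))" by blast
    have all: "bounded (u ` ({c<..<t} \<inter> {a..b}) \<union> u ` ({t<..<d} \<inter> {a..b}) \<union> {u t})"
      using c d by simp
    show ?case
    proof (intro exI[of _ "min (t - c) (d - t)"] conjI allI impI)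
      fix p q assume pq: "p \<le> t \<and> t \<le> q \<and> q - p < min (t - c) (d - t)"
      show "bounded (u ` ({p..q} \<inter> {a..b}))"
      proof (rule bounded_subset[OF all], rule subsetI)
        fix z assume "z \<in> u ` ({p..q} \<inter> {a..b})"
        then obtain y where y: "z = u y" "y \<in> {p..q} \<inter> {a..b}" by blast
        consider "y < t" | "y = t" | "t < y" by linarith
        then show "z \<in> u ` ({c<..<t} \<inter> {a..b}) \<union> u ` ({t<..<d} \<inter> {a..b}) \<union> {u t}"
          by cases (use y pq in auto)
      qed
    qed (use c d in auto)
  qed
  then show ?thesis by simp
qed simp

lemma piecewise_continuous_measurable:
  fixes u :: "real \<Rightarrow> 'a::euclidean_space"
  assumes pc: "piecewise_continuous a b u"
  shows "u \<in> borel_measurable (lebesgue_on {a..b})"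
proof -
  define F where "F = {t \<in> {a..b}. \<not> continuous (at t within {a..b}) u}"
  have F: "finite F" "F \<subseteq> {a..b}" using piecewise_continuousD(1)[OF pc] by (auto simp: F_def)
  have sets: "{a..b} - F \<in> sets lebesgue"
    using F by (intro sets.Diff) (auto intro: negligible_imp_sets negligible_finite)
  have "continuous_on ({a..b} - F) u"
    unfolding continuous_on_eq_continuous_within
    by (auto simp: F_def intro: continuous_within_subset)
  then have "u \<in> borel_measurable (lebesgue_on ({a..b} - F))"
    by (rule continuous_imp_measurable_on_sets_lebesgue[OF _ sets])
  then have "(\<lambda>t. if t \<in> {a..b} - F then u t else 0) \<in> borel_measurable lebesgue"
    by (rule borel_measurable_if_I[OF _ sets])
  then have "(\<lambda>t. if t \<in> {a..b} - F then u t else 0) \<in> borel_measurable (lebesgue_on {a..b})"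
    by (rule measurable_restrict_space1)
  then show ?thesis
  proof (rule measurable_discrete_difference)
    show "countable F" using F by (simp add: countable_finite)
    show "{t} \<in> sets (lebesgue_on {a..b})" if "t \<in> F" for t
      using that F by (auto simp: sets_restrict_space intro!: image_eqI[of _ _ "{t}"])
  qed (auto simp: space_restrict_space)
qed

lemma piecewise_continuous_hold_in_Linf_loc:
  "0 \<le> T \<Longrightarrow> piecewise_continuous 0 T u \<Longrightarrow> hold T u \<in> Linf_loc"
  by (intro hold_in_Linf_loc piecewise_continuous_measurable piecewise_continuous_bounded)

definition raise_from :: "real \<Rightarrow> 'a::plus \<Rightarrow> (real \<Rightarrow> 'a) \<Rightarrow> real \<Rightarrow> 'a"
  where "raise_from s e u t = (if s \<le> t then u t + e else u t)"

text \<open>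
  The perturbed input must compete under the same strict notion of piecewise continuity, which
  demands that its value at the new jump \<open>s\<close> be a one-sided limit. Here it is the right-hand one,
  because \<open>u\<close> is continuous from the right at \<open>s\<close>.
\<close>

lemma piecewise_continuous_raise_from:
  fixes u :: "real \<Rightarrow> 'a::real_normed_vector"
  assumes pc: "piecewise_continuous a b u" and s: "a \<le> s" "s < b"
    and right: "(u \<longlongrightarrow> u s) (at_right s)"
  shows "piecewise_continuous a b (raise_from s e u)"
proof -
  let ?v = "raise_from s e u"
  have low_l: "(?v \<longlongrightarrow> l) (at_left t) \<longleftrightarrow> (u \<longlongrightarrow> l) (at_left t)" if "t \<le> s" for t l
    by (rule filterlim_cong[OF refl refl])
      (use that in \<open>auto simp: eventually_at_filter raise_from_def\<close>)
  have low_r: "(?v \<longlongrightarrow> l) (at_right t) \<longleftrightarrow> (u \<longlongrightarrow> l) (at_right t)" if "t < s" for t l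
    by (rule filterlim_cong[OF refl refl])
      (use that in \<open>auto simp: eventually_at_right_field raise_from_def intro!: exI[of _ s]\<close>)
  have high_l: "(?v \<longlongrightarrow> l + e) (at_left t)" if "s < t" "(u \<longlongrightarrow> l) (at_left t)" for t l
  proof (rule Lim_transform_eventually)
    show "((\<lambda>r. u r + e) \<longlongrightarrow> l + e) (at_left t)" by (intro tendsto_intros that)
    show "\<forall>\<^sub>F r in at_left t. u r + e = ?v r"
      using that(1) by (auto simp: eventually_at_left_field raise_from_def intro!: exI[of _ s])
  qed
  have high_r: "(?v \<longlongrightarrow> l + e) (at_right t)" if "s \<le> t" "(u \<longlongrightarrow> l) (at_right t)" for t l
  proof (rule Lim_transform_eventually)
    show "((\<lambda>r. u r + e) \<longlongrightarrow> l + e) (at_right t)" by (intro tendsto_intros that)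
    show "\<forall>\<^sub>F r in at_right t. u r + e = ?v r"
      using that(1) by (auto simp: eventually_at_filter raise_from_def)
  qed
  have cont: "continuous (at t within {a..b}) ?v"
    if t: "t \<noteq> s" "continuous (at t within {a..b}) u" for t
  proof (cases "t < s")
    case True
    have "\<forall>\<^sub>F r in at t within {a..b}. r < s"
      using order_tendstoD(2)[OF tendsto_ident_at True] .
    then have "\<forall>\<^sub>F r in at t within {a..b}. u r = ?v r"
      by eventually_elim (simp add: raise_from_def)
    moreover have "(u \<longlongrightarrow> u t) (at t within {a..b})" using t(2) by (simp add: continuous_within)
    ultimately have "(?v \<longlongrightarrow> u t) (at t within {a..b})" by (rule Lim_transform_eventually[rotated])
    then show ?thesis using True by (simp add: continuous_within raise_from_def)
  next
    case False
    have "\<forall>\<^sub>F r in at t within {a..b}. s < r"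
      using order_tendstoD(1)[OF tendsto_ident_at, of s t] False t(1) by simp
    then have "\<forall>\<^sub>F r in at t within {a..b}. u r + e = ?v r"
      by eventually_elim (simp add: raise_from_def)
    moreover have "((\<lambda>r. u r + e) \<longlongrightarrow> u t + e) (at t within {a..b})"
      using t(2) by (intro tendsto_intros) (simp add: continuous_within)
    ultimately have "(?v \<longlongrightarrow> u t + e) (at t within {a..b})" by (rule Lim_transform_eventually[rotated])
    then show ?thesis using False by (simp add: continuous_within raise_from_def)
  qed
  have "finite {t \<in> {a..b}. \<not> continuous (at t within {a..b}) ?v}"
  proof (rule finite_subset)
    show "{t \<in> {a..b}. \<not> continuous (at t within {a..b}) ?v}
        \<subseteq> insert s {t \<in> {a..b}. \<not> continuous (at t within {a..b}) u}"
      using cont by blast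
    show "finite (insert s {t \<in> {a..b}. \<not> continuous (at t within {a..b}) u})"
      using piecewise_continuousD(1)[OF pc] by simp
  qed
  moreover have "\<exists>l. (?v \<longlongrightarrow> l) (at_left t)" if t: "t \<in> {a<..b}" for t
  proof -
    obtain l where "(u \<longlongrightarrow> l) (at_left t)"
      using piecewise_continuousD(2)[OF pc] t by auto
    then show ?thesis using low_l[of t l] high_l[of t l] by (cases "t \<le> s") auto
  qed
  moreover have "\<exists>l. (?v \<longlongrightarrow> l) (at_right t)" if t: "t \<in> {a..<b}" for t
  proof -
    obtain l where "(u \<longlongrightarrow> l) (at_right t)"
      using piecewise_continuousD(3)[OF pc] t by auto
    then show ?thesis using low_r[of t l] high_r[of t l] by (cases "t < s") auto
  qed
  moreover have "(a < t \<and> (?v \<longlongrightarrow> ?v t) (at_left t)) \<or> (t < b \<and> (?v \<longlongrightarrow> ?v t) (at_right t))"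
    if "t \<in> {a..b}" for t
  proof -
    have u_t: "(a < t \<and> (u \<longlongrightarrow> u t) (at_left t)) \<or> (t < b \<and> (u \<longlongrightarrow> u t) (at_right t))"
      using piecewise_continuousD(4)[OF pc] that by simp
    consider "t < s" | "t = s" | "s < t" by linarith
    then show ?thesis
    proof cases
      assume "t < s"
      then show ?thesis
        using u_t low_l[of t "u t"] low_r[of t "u t"] by (auto simp: raise_from_def)
    next
      assume "t = s"
      then show ?thesis using high_r[of s "u s"] right s by (simp add: raise_from_def)
    next
      assume "s < t"
      then show ?thesis
        using u_t high_l[of t "u t"] high_r[of t "u t"] by (auto simp: raise_from_def)
    qed
  qed
  ultimately show ?thesis unfolding piecewise_continuous_def by blast
qed

section \<open>The running cost\<close>

text \<open>
  The cost is a Henstock-Kurzweil integral, which is \<open>0\<close> by convention for a non-integrable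
  integrand. Comparing two costs therefore requires that both running costs be integrable.
\<close>

lemma integrable_continuous_compose:
  fixes u :: "real \<Rightarrow> 'b::euclidean_space" and x :: "real \<Rightarrow> 'a::euclidean_space"
    and L :: "'a \<times> 'b \<Rightarrow> real"
  assumes L: "continuous_on UNIV L" and x: "continuous_on {a..b} x"
    and u: "u \<in> borel_measurable (lebesgue_on {a..b})" "bounded (u ` {a..b})"
  shows "(\<lambda>t. L (x t, u t)) integrable_on {a..b}"
proof -
  have "x \<in> borel_measurable (lebesgue_on {a..b})"
    using x by (rule continuous_imp_measurable_on_sets_lebesgue) simp
  then have meas: "(\<lambda>t. L (x t, u t)) \<in> borel_measurable (lebesgue_on {a..b})"
    using u(1) L by (intro borel_measurable_continuous_on[OF L] borel_measurable_Pair)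
  define K where "K = closure (x ` {a..b}) \<times> closure (u ` {a..b})"
  have "compact K"
    unfolding K_def using u(2) compact_imp_bounded[OF compact_continuous_image[OF x compact_Icc]]
    by (intro compact_Times) (simp_all add: compact_closure)
  then have "bounded (L ` K)"
    by (intro compact_imp_bounded compact_continuous_image continuous_on_subset[OF L]) auto
  then obtain B where B: "\<And>z. z \<in> K \<Longrightarrow> norm (L z) \<le> B" unfolding bounded_iff by blast
  have in_K: "(x t, u t) \<in> K" if "t \<in> {a..b}" for t
    using that closure_subset[of "x ` {a..b}"] closure_subset[of "u ` {a..b}"]
    by (auto simp: K_def)
  show ?thesis
    by (rule measurable_bounded_by_integrable_imp_integrable[OF meas, of "\<lambda>_. B"])
      (use B in_K in auto)
qed

text \<open>
  Strictness at the end point alone suffices, since continuity spreads it to an interval of positive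
  length before the end point.
\<close>

lemma integral_less_if_less_at_right_end:
  fixes f g :: "real \<Rightarrow> real"
  assumes f: "f integrable_on {a..b}" and g: "g integrable_on {a..b}"
    and le: "\<And>t. t \<in> {a..b} \<Longrightarrow> f t \<le> g t" and s: "a \<le> s" "s < b"
    and cont: "continuous_on {s..b} f" "continuous_on {s..b} g" and less: "f b < g b"
  shows "integral {a..b} f < integral {a..b} g"
proof -
  let ?d = "\<lambda>t. g t - f t"
  have d: "?d integrable_on {a..b}" using g f by (rule integrable_diff)
  have "0 \<le> integral {a..s} ?d"
    using le s by (intro Henstock_Kurzweil_Integration.integral_nonneg integrable_subinterval_real[OF d]) auto
  moreover have "0 \<le> integral {s..b} ?d"
    using le s by (intro Henstock_Kurzweil_Integration.integral_nonneg integrable_subinterval_real[OF d]) auto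
  moreover have "integral {s..b} ?d \<noteq> 0"
  proof -
    have "continuous_on {s..b} ?d" by (intro continuous_intros cont)
    from integral_eq_0_iff[OF this \<open>s < b\<close>] show ?thesis
      using le s less by (auto intro!: bexI[of _ b])
  qed
  moreover have "integral {a..s} ?d + integral {s..b} ?d = integral {a..b} ?d"
    by (rule Henstock_Kurzweil_Integration.integral_combine) (use s d in auto)
  moreover have "integral {a..b} ?d = integral {a..b} g - integral {a..b} f"
    by (rule integral_diff[OF g f])
  ultimately show ?thesis by linarith
qed

section \<open>Raising the input near the final time\<close>

lemma uniformly_positive_near:
  fixes h :: "(real ^ 'n) \<times> (real ^ 'm) \<Rightarrow> real ^ 's"
  assumes h: "continuous_on UNIV h" and pos: "0 \<lless> h (\<xi>, v)"
  obtains r where "0 < r" "\<And>\<xi>' v'. dist \<xi>' \<xi> < r \<Longrightarrow> dist v' v < r \<Longrightarrow> 0 \<le> h (\<xi>', v')"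
proof -
  define P where "P = (\<Inter>k. {z. 0 < h z $ k})"
  have "open P"
    unfolding P_def using h by (intro open_INT ballI open_Collect_less continuous_intros) auto
  moreover have "(\<xi>, v) \<in> P" using pos by (simp add: P_def vec_ll_def)
  ultimately obtain e where e: "0 < e" "ball (\<xi>, v) e \<subseteq> P"
    using open_contains_ball by blast
  show thesis
  proof (rule that[of "e / 2"])
    fix \<xi>' v' assume "dist \<xi>' \<xi> < e / 2" "dist v' v < e / 2"
    moreover have "dist (\<xi>', v') (\<xi>, v) \<le> dist \<xi>' \<xi> + dist v' v"
      using norm_Pair_le[of "\<xi>' - \<xi>" "v' - v"] by (simp add: dist_norm)
    ultimately have "(\<xi>', v') \<in> ball (\<xi>, v) e" by (simp add: dist_commute)
    then have "(\<xi>', v') \<in> P" using e by blast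
    then show "0 \<le> h (\<xi>', v')" by (auto simp: P_def less_eq_vec_def intro: less_imp_le)
  qed (use e in simp)
qed

text \<open>
  A piecewise continuous input is continuous at the final time and has only finitely many
  discontinuities, so on a short enough final interval it is continuous and close to its final
  value. Here \<open>M\<close> is a speed bound: the interval is also chosen so short that a motion of speed \<open>M\<close>
  covers less than \<open>\<rho>\<close>.
\<close>

lemma late_interval:
  fixes u :: "real \<Rightarrow> 'a::metric_space" and x :: "real \<Rightarrow> 'b::metric_space"
  assumes "a < b" and pc: "piecewise_continuous a b u" and x: "continuous_on {a..b} x"
    and "0 < \<rho>"
  obtains s where "a < s" "s < b" "M * (b - s) < \<rho>" "continuous_on {s..b} u"
    "\<And>t. t \<in> {s..b} \<Longrightarrow> dist (u t) (u b) < \<rho>"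
    "\<And>t. t \<in> {s..b} \<Longrightarrow> dist (x t) (x b) < \<rho>"
    "(u \<longlongrightarrow> u s) (at_right s)"
proof -
  define F where "F = {t \<in> {a..b}. \<not> continuous (at t within {a..b}) u}"
  have u_b: "(u \<longlongrightarrow> u b) (at_left b)"
    using piecewise_continuousD(4)[OF pc, of b] \<open>a < b\<close> by auto
  have "(x \<longlongrightarrow> x b) (at b within {a..b})"
    using x \<open>a < b\<close> by (simp add: continuous_on)
  then have x_b: "(x \<longlongrightarrow> x b) (at_left b)"
    using at_within_Icc_at_left[OF \<open>a < b\<close>] by simp
  have "((\<lambda>t. M * (b - t)) \<longlongrightarrow> M * (b - b)) (at_left b)" by (intro tendsto_intros)
  then have "\<forall>\<^sub>F t in at_left b. M * (b - t) < \<rho>"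
    by (rule order_tendstoD) (use \<open>0 < \<rho>\<close> in simp)
  moreover have "\<forall>\<^sub>F t in at_left b. \<forall>p\<in>F. t \<noteq> p"
  proof (rule eventually_ball_finite)
    show "finite F" using piecewise_continuousD(1)[OF pc] by (simp add: F_def)
    show "\<forall>p\<in>F. \<forall>\<^sub>F t in at_left b. t \<noteq> p" by (auto intro: eventually_neq_at_within)
  qed
  moreover have "\<forall>\<^sub>F t in at_left b. a < t"
    using \<open>a < b\<close> by (auto simp: eventually_at_left_field)
  ultimately have "\<forall>\<^sub>F t in at_left b. M * (b - t) < \<rho> \<and> t \<notin> F \<and> a < t
      \<and> dist (u t) (u b) < \<rho> \<and> dist (x t) (x b) < \<rho>"
    using tendstoD[OF u_b \<open>0 < \<rho>\<close>] tendstoD[OF x_b \<open>0 < \<rho>\<close>] by eventually_elim auto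
  then obtain c where "c < b" and c: "\<And>t. c < t \<Longrightarrow> t < b \<Longrightarrow> M * (b - t) < \<rho> \<and> t \<notin> F \<and> a < t
      \<and> dist (u t) (u b) < \<rho> \<and> dist (x t) (x b) < \<rho>"
    unfolding eventually_at_left_field by blast
  define s where "s = (c + b) / 2"
  have s: "c < s" "s < b" using \<open>c < b\<close> by (simp_all add: s_def)
  then have "a < s" using c by blast
  have cont: "continuous (at t within {a..b}) u" if "s \<le> t" "t < b" for t
    using c[of t] that s by (auto simp: F_def)
  show thesis
  proof (rule that[of s])
    show "continuous_on {s..b} u"
      unfolding continuous_on_eq_continuous_within
    proof
      fix t assume t: "t \<in> {s..b}"
      show "continuous (at t within {s..b}) u"
      proof (cases "t < b")
        case True
        then show ?thesis
          using cont[of t] t \<open>a < s\<close> by (auto intro: continuous_within_subset)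
      next
        case False
        then have "t = b" using t by simp
        then show ?thesis
          using u_b at_within_Icc_at_left[OF \<open>s < b\<close>] by (simp add: continuous_within)
      qed
    qed
    show "(u \<longlongrightarrow> u s) (at_right s)"
    proof -
      have "(u \<longlongrightarrow> u s) (at s within {s..b})"
        using \<open>continuous_on {s..b} u\<close> s by (simp add: continuous_on)
      then show ?thesis using at_within_Icc_at_right[OF \<open>s < b\<close>] by simp
    qed
    fix t assume "t \<in> {s..b}"
    then have "t = b \<or> (c < t \<and> t < b)" using s by auto
    then show "dist (u t) (u b) < \<rho>" "dist (x t) (x b) < \<rho>"
      using c[of t] \<open>0 < \<rho>\<close> by auto
  qed (use c[of s] s in auto)
qed

theorem corollaryI3:
  fixes f :: "(real ^ 'n) \<times> (real ^ 'm) \<Rightarrow> real ^ 'n"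
    and L :: "(real ^ 'n) \<times> (real ^ 'm) \<Rightarrow> real"
    and h :: "(real ^ 'n) \<times> (real ^ 'm) \<Rightarrow> real ^ 's"
    and t\<^sub>f :: real
    and x\<^sub>0 :: "real ^ 'n"
    and u :: "real \<Rightarrow> real ^ 'm"
    and x :: "real \<Rightarrow> real ^ 'n"
  assumes "t\<^sub>f > 0"
    and "continuously_differentiable f"
    and "well_posed f"
    and H1: "monotone_control_system f"
    and H2: "continuous_on UNIV L"
      "\<And>\<xi>\<^sub>1 \<xi>\<^sub>2 v\<^sub>1 v\<^sub>2. \<xi>\<^sub>1 \<le> \<xi>\<^sub>2 \<Longrightarrow> v\<^sub>1 \<le> v\<^sub>2 \<Longrightarrow> L (\<xi>\<^sub>1, v\<^sub>1) \<le> L (\<xi>\<^sub>2, v\<^sub>2)"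
    and H3: "(\<forall>\<xi> v\<^sub>1 v\<^sub>2. v\<^sub>1 < v\<^sub>2 \<longrightarrow> L (\<xi>, v\<^sub>1) < L (\<xi>, v\<^sub>2)) \<or>
      (excitable f \<and> (\<forall>v \<xi>\<^sub>1 \<xi>\<^sub>2. \<xi>\<^sub>1 \<lless> \<xi>\<^sub>2 \<longrightarrow> L (\<xi>\<^sub>1, v) < L (\<xi>\<^sub>2, v)))"
    and H4: "continuous_on UNIV h"
      "\<And>\<xi> v w j k. v $ j \<le> w $ j \<Longrightarrow> (\<And>i. i \<noteq> j \<Longrightarrow> v $ i = w $ i)
         \<Longrightarrow> h (\<xi>, w) $ k \<le> h (\<xi>, v) $ k"
    and "piecewise_continuous 0 t\<^sub>f u"
    and "admissible f h t\<^sub>f u x"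
    and "x 0 = x\<^sub>0"
    and "\<exists>t\<^sub>0. 0 \<le> t\<^sub>0 \<and> t\<^sub>0 < t\<^sub>f \<and> (\<forall>t\<in>{t\<^sub>0..t\<^sub>f}. 0 \<lless> h (x t, u t))"
  shows "\<not> optimal f L h t\<^sub>f x\<^sub>0 u x"
proof
  assume optimal: "optimal f L h t\<^sub>f x\<^sub>0 u x"
  note pc = \<open>piecewise_continuous 0 t\<^sub>f u\<close> and wp = \<open>well_posed f\<close>
  have traj_x: "trajectory f t\<^sub>f u x" and h_x: "\<And>t. t \<in> {0..t\<^sub>f} \<Longrightarrow> 0 \<le> h (x t, u t)"
    using \<open>admissible f h t\<^sub>f u x\<close> by (auto simp: admissible_def)
  have cont_x: "continuous_on {0..t\<^sub>f} x"
    using traj_x by (rule trajectory_imp_continuous_on)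
  have cont_f: "continuous_on UNIV f"
  proof -
    obtain f' where "\<And>z. (f has_derivative blinfun_apply (f' z)) (at z)"
      using \<open>continuously_differentiable f\<close> unfolding continuously_differentiable_def by blast
    then show ?thesis by (rule has_derivative_continuous_on)
  qed

  have "0 \<lless> h (x t\<^sub>f, u t\<^sub>f)"
    using \<open>\<exists>t\<^sub>0. _ t\<^sub>0\<close> by auto
  then obtain r where "0 < r" and
    h_near: "\<And>\<xi> v. dist \<xi> (x t\<^sub>f) < r \<Longrightarrow> dist v (u t\<^sub>f) < r \<Longrightarrow> 0 \<le> h (\<xi>, v)"
    using uniformly_positive_near[OF H4(1)] by metis
  \<comment> \<open>The increment: equal positive entries, scaled so that its norm stays below \<open>r / 2\<close>.\<close>
  define e :: "real ^ 'm" where "e = (r / (2 * (1 + norm (1 :: real ^ 'm)))) *\<^sub>R 1"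
  have e_pos: "e $ i > 0" for i
    using \<open>0 < r\<close> norm_ge_zero[of "1 :: real ^ 'm"] by (simp add: e_def add_pos_nonneg)
  have less_e: "w < w + e" for w :: "real ^ 'm"
    using e_pos by (simp add: less_vec_def less_eq_vec_def less_imp_le not_le)
  have norm_e: "norm e < r / 2"
  proof -
    have "norm e = r / 2 * (norm (1 :: real ^ 'm) / (1 + norm (1 :: real ^ 'm)))"
      using \<open>0 < r\<close> by (simp add: e_def)
    also have "\<dots> < r / 2 * 1"
      using \<open>0 < r\<close> norm_ge_zero[of "1 :: real ^ 'm"]
      by (intro mult_strict_left_mono) (simp_all add: divide_less_eq add_pos_nonneg)
    finally show ?thesis by simp
  qed
  \<comment> \<open>The speed bound \<open>M\<close> must be fixed before \<open>s\<close>, as it determines how close \<open>s\<close> is to \<open>t\<^sub>f\<close>.\<close>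
  have "bounded (f ` (cball (x t\<^sub>f) r \<times> cball (u t\<^sub>f) r))"
    by (intro compact_imp_bounded compact_continuous_image compact_Times compact_cball
        continuous_on_subset[OF cont_f]) simp
  then obtain M where "0 < M" and
    M: "\<And>\<xi> v. dist \<xi> (x t\<^sub>f) < r \<Longrightarrow> dist v (u t\<^sub>f) < r \<Longrightarrow> norm (f (\<xi>, v)) \<le> M"
    unfolding bounded_pos by (auto simp: dist_commute less_imp_le)
  obtain s where "0 < s" "s < t\<^sub>f" and short: "M * (t\<^sub>f - s) < r / 2" and
    cont_u: "continuous_on {s..t\<^sub>f} u" and
    near_u: "\<And>t. t \<in> {s..t\<^sub>f} \<Longrightarrow> dist (u t) (u t\<^sub>f) < r / 2" and
    near_x: "\<And>t. t \<in> {s..t\<^sub>f} \<Longrightarrow> dist (x t) (x t\<^sub>f) < r / 2" and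
    right_s: "(u \<longlongrightarrow> u s) (at_right s)"
    using late_interval[OF \<open>t\<^sub>f > 0\<close> pc cont_x, of "r / 2" M] \<open>0 < r\<close> by auto

  define v where "v = raise_from s e u"
  have v_low: "v t = u t" if "t < s" for t using that by (simp add: v_def raise_from_def)
  have v_high: "v t = u t + e" if "s \<le> t" for t using that by (simp add: v_def raise_from_def)
  have u_le_v: "u t \<le> v t" for t
    using less_e by (simp add: v_def raise_from_def less_imp_le)
  have pc_v: "piecewise_continuous 0 t\<^sub>f v"
    unfolding v_def using \<open>0 < s\<close> \<open>s < t\<^sub>f\<close> right_s
    by (intro piecewise_continuous_raise_from[OF pc]) auto
  define wu where "wu = hold t\<^sub>f u"
  define wv where "wv = hold t\<^sub>f v"
  have Linf: "wu \<in> Linf_loc" "wv \<in> Linf_loc"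
    unfolding wu_def wv_def using pc pc_v \<open>t\<^sub>f > 0\<close>
    by (auto intro: piecewise_continuous_hold_in_Linf_loc)
  have wu: "wu t = u t" and wv: "wv t = v t" if "t \<le> t\<^sub>f" for t
    using that by (simp_all add: wu_def wv_def hold_def)
  have traj_wx: "trajectory f t\<^sub>f wu x"
    by (rule trajectory_cong[OF traj_x, of "{}"]) (auto simp: wu)
  obtain y where traj_wy: "trajectory f t\<^sub>f wv y" and y0: "y 0 = x\<^sub>0"
    using wp Linf(2) \<open>t\<^sub>f > 0\<close> unfolding well_posed_def by blast
  have traj_y: "trajectory f t\<^sub>f v y"
    by (rule trajectory_cong[OF traj_wy, of "{}"]) (auto simp: wv)
  have cont_y: "continuous_on {0..t\<^sub>f} y"
    using traj_y by (rule trajectory_imp_continuous_on)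

  have y_early: "y t = x t" if "t \<in> {0..s}" for t
  proof (rule trajectory_unique[OF wp Linf(1) _ _ _ that])
    show "trajectory f s wu x" "y 0 = x 0"
      using trajectory_restrict[OF traj_wx] \<open>s < t\<^sub>f\<close> y0 \<open>x 0 = x\<^sub>0\<close> by auto
    \<comment> \<open>At the time \<open>s\<close> itself the two inputs differ, hence the exceptional set \<open>{s}\<close>.\<close>
    have "trajectory f s wv y" using trajectory_restrict[OF traj_wy] \<open>s < t\<^sub>f\<close> by simp
    then show "trajectory f s wu y"
      by (rule trajectory_cong[of _ _ _ _ "{s}"]) (use \<open>s < t\<^sub>f\<close> in \<open>auto simp: wu wv v_low\<close>)
  qed
  have near_v: "dist (v t) (u t\<^sub>f) < r" if "t \<in> {s..t\<^sub>f}" for t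
  proof -
    have "dist (v t) (u t\<^sub>f) \<le> dist (u t) (u t\<^sub>f) + norm e"
      using norm_triangle_ineq[of "u t - u t\<^sub>f" e] that
      by (simp add: v_high dist_norm algebra_simps)
    then show ?thesis using near_u[OF that] norm_e by linarith
  qed
  have y_near: "dist \<xi> (x t\<^sub>f) < r" if "dist \<xi> (y s) < r / 2" for \<xi>
    using dist_triangle[of \<xi> "x t\<^sub>f" "y s"] that near_x[of s] y_early[of s] \<open>0 < s\<close> \<open>s < t\<^sub>f\<close>
    by simp
  \<comment> \<open>The new trajectory starts within \<open>r / 2\<close> of \<open>x t\<^sub>f\<close> at time \<open>s\<close> and has no time to travel
    another \<open>r / 2\<close>.\<close>
  have near_y: "dist (y t) (x t\<^sub>f) < r" if "t \<in> {s..t\<^sub>f}" for t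
  proof (rule y_near, rule absolutely_continuous_on_trapped[OF _ _ _ short _ that])
    show "absolutely_continuous_on {s..t\<^sub>f} y"
      using traj_y absolutely_continuous_on_subset[of "{0..t\<^sub>f}" y "{s..t\<^sub>f}"] \<open>0 < s\<close>
      by (simp add: trajectory_def)
    let ?N = "{t \<in> {0..t\<^sub>f}. \<not> (y has_vector_derivative f (y t, v t)) (at t within {0..t\<^sub>f})}"
    show "negligible ?N" using traj_y by (simp add: trajectory_iff)
    fix t assume t: "t \<in> {s..t\<^sub>f} - ?N" "dist (y t) (y s) < r / 2"
    then have "(y has_vector_derivative f (y t, v t)) (at t within {0..t\<^sub>f})"
      using \<open>0 < s\<close> by auto
    then have "(y has_vector_derivative f (y t, v t)) (at t within {s..t\<^sub>f})"
      by (rule has_vector_derivative_within_subset) (use \<open>0 < s\<close> in auto)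
    moreover have "norm (f (y t, v t)) \<le> M"
      using t by (intro M y_near near_v) auto
    ultimately show "\<exists>D. (y has_vector_derivative D) (at t within {s..t\<^sub>f}) \<and> norm D \<le> M"
      by blast
  qed (use \<open>0 < M\<close> in simp)
  have "admissible f h t\<^sub>f v y"
    unfolding admissible_def
  proof (intro conjI ballI traj_y)
    fix t assume t: "t \<in> {0..t\<^sub>f}"
    show "0 \<le> h (y t, v t)"
    proof (cases "t < s")
      case True
      then show ?thesis using h_x[OF t] y_early[of t] t by (simp add: v_low)
    next
      case False
      then show ?thesis using t by (intro h_near near_y near_v) auto
    qed
  qed
  then have cost_le: "cost f L t\<^sub>f x\<^sub>0 v \<le> cost f L t\<^sub>f x\<^sub>0 u"
    using optimal pc_v y0 unfolding optimal_def by blast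

  have state_u: "state f t x\<^sub>0 u = x t" and state_wu: "state f t x\<^sub>0 wu = x t"
    and state_v: "state f t x\<^sub>0 v = y t" and state_wv: "state f t x\<^sub>0 wv = y t"
    if "t \<in> {0..t\<^sub>f}" for t
  proof -
    show *: "state f t x\<^sub>0 wu = x t" "state f t x\<^sub>0 wv = y t"
      using state_eq[OF wp Linf(1) traj_wx, of t] state_eq[OF wp Linf(2) traj_wy, of t] that
        y0 \<open>x 0 = x\<^sub>0\<close> by auto
    show "state f t x\<^sub>0 u = x t"
      unfolding *(1)[symmetric] by (rule state_cong) (use that in \<open>auto simp: wu\<close>)
    show "state f t x\<^sub>0 v = y t"
      unfolding *(2)[symmetric] by (rule state_cong) (use that in \<open>auto simp: wv\<close>)
  qed
  have x_le_y: "x t \<le> y t" if "t \<in> {0..t\<^sub>f}" for t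
  proof -
    have "state f t x\<^sub>0 wu \<le> state f t x\<^sub>0 wv"
      using H1 Linf that u_le_v unfolding monotone_control_system_def
      by (auto simp: wu_def wv_def hold_def)
    then show ?thesis using that by (simp add: state_wu state_wv)
  qed

  have "L (x t\<^sub>f, u t\<^sub>f) < L (y t\<^sub>f, v t\<^sub>f)"
    using H3
  proof (elim disjE conjE)
    assume "\<forall>\<xi> v\<^sub>1 v\<^sub>2. v\<^sub>1 < v\<^sub>2 \<longrightarrow> L (\<xi>, v\<^sub>1) < L (\<xi>, v\<^sub>2)"
    then have "L (x t\<^sub>f, u t\<^sub>f) < L (x t\<^sub>f, v t\<^sub>f)"
      using less_e \<open>s < t\<^sub>f\<close> by (simp add: v_high)
    also have "\<dots> \<le> L (y t\<^sub>f, v t\<^sub>f)"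
      using x_le_y[of t\<^sub>f] \<open>t\<^sub>f > 0\<close> by (intro H2(2)) auto
    finally show ?thesis .
  next
    assume "excitable f" and L: "\<forall>v \<xi>\<^sub>1 \<xi>\<^sub>2. \<xi>\<^sub>1 \<lless> \<xi>\<^sub>2 \<longrightarrow> L (\<xi>\<^sub>1, v) < L (\<xi>\<^sub>2, v)"
    \<comment> \<open>Both trajectories pass through \<open>x s\<close> at time \<open>s\<close>. Restarted there, their inputs are strictly
      ordered at all times, as excitability demands.\<close>
    define T where "T = t\<^sub>f - s"
    define p where "p = hold T (\<lambda>t. u (s + t))"
    define q where "q = hold T (\<lambda>t. u (s + t) + e)"
    have "0 < T" using \<open>s < t\<^sub>f\<close> by (simp add: T_def)
    have cont: "continuous_on {0..T} (\<lambda>t. u (s + t))"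
      by (rule continuous_on_compose2[OF cont_u]) (auto simp: T_def intro!: continuous_intros)
    have Linf_hold: "hold T w \<in> Linf_loc" if "continuous_on {0..T} w" for w :: "real \<Rightarrow> real ^ 'm"
      using that \<open>0 < T\<close>
      by (intro hold_in_Linf_loc continuous_imp_measurable_on_sets_lebesgue
          compact_imp_bounded compact_continuous_image) auto
    have pq: "p \<in> Linf_loc" "q \<in> Linf_loc"
      unfolding p_def q_def by (intro Linf_hold continuous_intros cont)+
    have "trajectory f T (\<lambda>t. u (s + t)) (\<lambda>t. x (s + t))"
      unfolding T_def using trajectory_shift[OF traj_x] \<open>0 < s\<close> by simp
    then have "trajectory f T p (\<lambda>t. x (s + t))"
      by (rule trajectory_cong[of _ _ _ _ "{}"]) (auto simp: p_def hold_def)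
    from state_eq[OF wp pq(1) this, of T] have x_end: "state f T (x s) p = x t\<^sub>f"
      using \<open>0 < T\<close> by (simp add: T_def)
    have "trajectory f T (\<lambda>t. v (s + t)) (\<lambda>t. y (s + t))"
      unfolding T_def using trajectory_shift[OF traj_y] \<open>0 < s\<close> by simp
    then have "trajectory f T q (\<lambda>t. y (s + t))"
      by (rule trajectory_cong[of _ _ _ _ "{}"]) (auto simp: q_def hold_def v_high)
    from state_eq[OF wp pq(2) this, of T] have y_end: "state f T (x s) q = y t\<^sub>f"
      using \<open>0 < T\<close> y_early[of s] \<open>0 < s\<close> by (simp add: T_def)
    have "state f T (x s) p \<lless> state f T (x s) q"
      using \<open>excitable f\<close> pq \<open>0 < T\<close> less_e unfolding excitable_def
      by (auto simp: p_def q_def hold_def)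
    then have "L (x t\<^sub>f, u t\<^sub>f) < L (y t\<^sub>f, u t\<^sub>f)"
      using L by (simp add: x_end y_end)
    also have "\<dots> \<le> L (y t\<^sub>f, v t\<^sub>f)" by (intro H2(2) u_le_v) simp
    finally show ?thesis .
  qed
  then have "integral {0..t\<^sub>f} (\<lambda>t. L (x t, u t)) < integral {0..t\<^sub>f} (\<lambda>t. L (y t, v t))"
  proof (rule integral_less_if_less_at_right_end[rotated 7])
    show "(\<lambda>t. L (x t, u t)) integrable_on {0..t\<^sub>f}"
      by (intro integrable_continuous_compose H2 cont_x piecewise_continuous_measurable
          piecewise_continuous_bounded pc)
    show "(\<lambda>t. L (y t, v t)) integrable_on {0..t\<^sub>f}"
      by (intro integrable_continuous_compose H2 cont_y piecewise_continuous_measurable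
          piecewise_continuous_bounded pc_v)
    have cont_v: "continuous_on {s..t\<^sub>f} v"
      using cont_u by (subst continuous_on_cong[OF refl v_high]) (auto intro!: continuous_intros)
    have sub: "{s..t\<^sub>f} \<subseteq> {0..t\<^sub>f}" using \<open>0 < s\<close> by auto
    show "continuous_on {s..t\<^sub>f} (\<lambda>t. L (x t, u t))" "continuous_on {s..t\<^sub>f} (\<lambda>t. L (y t, v t))"
      using cont_u cont_v continuous_on_subset[OF cont_x sub] continuous_on_subset[OF cont_y sub]
      by (auto intro!: continuous_on_compose2[OF H2(1)] continuous_intros)
  qed (use x_le_y u_le_v H2(2) \<open>0 < s\<close> \<open>s < t\<^sub>f\<close> in auto)
  also have "integral {0..t\<^sub>f} (\<lambda>t. L (x t, u t)) = cost f L t\<^sub>f x\<^sub>0 u"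
    unfolding cost_def by (rule integral_cong) (simp add: state_u)
  also have "integral {0..t\<^sub>f} (\<lambda>t. L (y t, v t)) = cost f L t\<^sub>f x\<^sub>0 v"
    unfolding cost_def by (rule integral_cong) (simp add: state_v)
  finally show False using cost_le by simp
qed

end
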